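(* Assume the rainbow Erdős Matching Conjecture (stated in the context). Then the $q$-quantile share is universally feasible for $q=1/e$. This is best possible: for no $q\in(0,1)$ with $q>1/e$ is the $q$-quantile share universally feasible.
   Context: Let $[m]=\{1,\dots,m\}$ be a set of indivisible goods and $n\ge 2$ the number of agents. A monotone valuation on $[m]$ is a function $v:2^{[m]}\to\mathbb{R}_{\ge 0}$ with $v(\emptyset)=0$ and $v(A)\le v(B)$ whenever $A\subseteq B$. An allocation is an $n$-tuple $(S_1,\dots,S_n)$ of pairwise disjoint (possibly empty) subsets of $[m]$ whose union is $[m]$. Let $X\subseteq[m]$ be the random bundle obtained by including each good independently with probability $1/n$. For $q\in(0,1)$, the $q$-quantile share is $\tau_q(v,n):=\min\{t\in v(2^{[m]}):\mathbb{P}[v(X)\le t]\ge q\}$. A share $\tau$ is universally feasible if for every profile $(v_1,\dots,v_n)$ of monotone valuations (any number of agents $n\ge 2$, any finite set of goods $[m]$) there is an allocation $(S_1,\dots,S_n)$ with $v_i(S_i)\ge\tau(v_i,n)$ for all $i\in[n]$. Families $\mathcal F_1,\dots,\mathcal F_n$ of subsets of $[M]$ are cross-dependent if there do not exist pairwise disjoint sets $F_1\in\mathcal F_1,\dots,F_n\in\mathcal F_n$. The rainbow Erdős Matching Conjecture is the assertion: for all positive integers $n,k,M$ with $M\ge nk$, if $\mathcal F_1,\dots,\mathcal F_n\subseteq\binom{[M]}{k}$ are cross-dependent, then $$\min_{j\in[n]}|\mathcal F_j|\le\max\left\{\binom{M}{k}-\binom{M-n+1}{k},\ \binom{kn-1}{k}\right\}.$$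 Here $\binom{[M]}{k}$ denotes the set of all $k$-element subsets of $[M]$. *)

theory Defs
  imports "HOL-Probability.Probability" "HOL-Library.Ramsey"
begin

text \<open>
  Goods are the natural numbers in \<^term>\<open>{1..m}\<close> and agents those in \<^term>\<open>{1..n}\<close>.
  A valuation on \<^term>\<open>{1..m}\<close> is a function on all sets of naturals of which only the
  values on subsets of \<^term>\<open>{1..m}\<close> are constrained or used.
\<close>

definition monotone_valuation :: "nat \<Rightarrow> (nat set \<Rightarrow> real) \<Rightarrow> bool" where
  "monotone_valuation m v \<longleftrightarrow>
     v {} = 0 \<and> (\<forall>A \<subseteq> {1..m}. 0 \<le> v A) \<and> (\<forall>A B. A \<subseteq> B \<and> B \<subseteq> {1..m} \<longrightarrow> v A \<le> v B)"

definition allocation :: "nat \<Rightarrow> nat \<Rightarrow> (nat \<Rightarrow> nat set) \<Rightarrow> bool" where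
  "allocation m n S \<longleftrightarrow> disjoint_family_on S {1..n} \<and> (\<Union>i\<in>{1..n}. S i) = {1..m}"

definition random_bundle :: "nat \<Rightarrow> nat \<Rightarrow> nat set pmf" where
  "random_bundle m n =
     map_pmf (\<lambda>f. {g \<in> {1..m}. f g}) (Pi_pmf {1..m} False (\<lambda>_. bernoulli_pmf (1 / real n)))"

definition quantile_share :: "real \<Rightarrow> nat \<Rightarrow> (nat set \<Rightarrow> real) \<Rightarrow> nat \<Rightarrow> real" where
  "quantile_share q m v n =
     Min {t \<in> v ` Pow {1..m}. measure_pmf.prob (random_bundle m n) {X. v X \<le> t} \<ge> q}"

text \<open>
  A share takes the number of goods \<open>m\<close> as an explicit argument, since the domain
  \<^term>\<open>Pow {1..m}\<close> of a valuation cannot be recovered from the total function.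
\<close>

definition universally_feasible :: "(nat \<Rightarrow> (nat set \<Rightarrow> real) \<Rightarrow> nat \<Rightarrow> real) \<Rightarrow> bool" where
  "universally_feasible \<tau> \<longleftrightarrow>
     (\<forall>n\<ge>2. \<forall>m. \<forall>v. (\<forall>i\<in>{1..n}. monotone_valuation m (v i)) \<longrightarrow>
        (\<exists>S. allocation m n S \<and> (\<forall>i\<in>{1..n}. v i (S i) \<ge> \<tau> m (v i) n)))"

definition cross_dependent :: "nat \<Rightarrow> (nat \<Rightarrow> nat set set) \<Rightarrow> bool" where
  "cross_dependent n \<F> \<longleftrightarrow>
     \<not> (\<exists>F. (\<forall>j\<in>{1..n}. F j \<in> \<F> j) \<and> disjoint_family_on F {1..n})"

text \<open>
  \<^term>\<open>nsets {1..M} k\<close> is the set of all \<open>k\<close>-element subsets of \<^term>\<open>{1..M}\<close>.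
  The subtractions on naturals below do not truncate, as \<open>1 \<le> n \<le> M\<close> and \<open>1 \<le> k * n\<close>.
\<close>

definition rainbow_Erdos_Matching_Conjecture :: bool where
  "rainbow_Erdos_Matching_Conjecture \<longleftrightarrow>
     (\<forall>n k M. n > 0 \<longrightarrow> k > 0 \<longrightarrow> M > 0 \<longrightarrow> M \<ge> n * k \<longrightarrow>
        (\<forall>\<F>. (\<forall>j\<in>{1..n}. \<F> j \<subseteq> nsets {1..M} k) \<longrightarrow> cross_dependent n \<F> \<longrightarrow>
           Min ((\<lambda>j. card (\<F> j)) ` {1..n})
             \<le> max ((M choose k) - ((M - n + 1) choose k)) ((k * n - 1) choose k)))"

end

theory Submission
  imports Defs "HOL-Real_Asymp.Real_Asymp"
begin

text \<open>
  Feasibility.  Let \<open>t\<^sub>i\<close> be the share of agent \<open>i\<close> and let \<open>G\<^sub>i\<close> consist of the bundles that are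
  worth at least \<open>t\<^sub>i\<close> to that agent.  Since \<open>t\<^sub>i\<close> is a minimal quantile, the random bundle lies in
  \<open>G\<^sub>i\<close> with probability strictly above \<open>1 - 1 / e\<close>, and pairwise disjoint bundles
  \<open>F\<^sub>i \<in> G\<^sub>i\<close> are all that is needed: leftover goods can go to anyone.  The conjecture speaks of
  uniform families rather than of the product measure, so the goods are embedded in a ground set of
  size \<open>M\<close>, and \<open>G\<^sub>i\<close> is replaced by the family of \<open>k\<close>-subsets of \<open>{1..M}\<close> whose trace on the
  goods lies in \<open>G\<^sub>i\<close>.  Disjoint \<open>k\<close>-sets have disjoint traces, so these families are
  cross-dependent if no disjoint \<open>F\<^sub>i\<close> exist.  When \<open>k\<close> grows and \<open>k / M\<close> tends to \<open>1 / n\<close>, the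
  density of the \<open>i\<close>-th family among the \<open>k\<close>-sets tends to the probability of \<open>G\<^sub>i\<close>
  (\<open>tendsto_binomial_ratio\<close>, \<open>card_nsets_trace_in\<close>), while the first term of the conjectured bound
  has density tending to \<open>1 - (1 - 1 / n) ^ (n - 1) \<le> 1 - 1 / e\<close>.

  The second term, the \<open>k\<close>-subsets of a set of size \<open>k n - 1\<close>, dictates how \<open>k / M\<close> has to
  approach \<open>1 / n\<close>.  For \<open>M = n k\<close> its density is \<open>1 - 1 / n\<close>, which exceeds \<open>1 - 1 / e\<close> once
  \<open>n \<ge> 3\<close>.  But its density is at most \<open>(k n / M) ^ k\<close>, so that with \<open>k = L\<^sup>2\<close> and
  \<open>M = n L\<^sup>2 + L\<close> it vanishes in the limit, although \<open>k / M\<close> still tends to \<open>1 / n\<close>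
  (\<open>tendsto_clique_ratio\<close>).  For large \<open>L\<close> all families are thus larger than the conjectured bound, a
  contradiction (\<open>disjoint_selection_of_large_measure\<close>).

  Optimality.  Let \<open>n - 1\<close> goods be given, and let every agent value each nonempty bundle at \<open>1\<close>.  The
  random bundle is empty with probability \<open>(1 - 1 / n) ^ (n - 1)\<close>, which tends to \<open>1 / e\<close>; for
  \<open>q > 1 / e\<close> and large \<open>n\<close> the share is therefore \<open>1\<close>, and \<open>n\<close> agents cannot all receive a good.
\<close>

section \<open>The random bundle\<close>

lemma set_pmf_random_bundle: "set_pmf (random_bundle m n) \<subseteq> Pow {1..m}"
  by (auto simp: random_bundle_def)

lemma pmf_random_bundle:
  assumes n: "n \<ge> 2" and B: "B \<subseteq> {1..m}"
  shows "pmf (random_bundle m n) B = (1 / n) ^ card B * (1 - 1 / n) ^ (m - card B)"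
proof -
  define P where "P = Pi_pmf {1..m} False (\<lambda>_. bernoulli_pmf (1 / real n))"
  define b where "b = (\<lambda>f. {g \<in> {1..m}. f g})"
  \<comment> \<open>Functions in the support are \<open>False\<close> outside \<open>{1..m}\<close>, so the bundle determines them.\<close>
  have inj: "inj_on b (set_pmf P)"
  proof (rule inj_onI, rule ext)
    fix f f' g
    assume f: "f \<in> set_pmf P" "f' \<in> set_pmf P" "b f = b f'"
    have "f \<in> PiE_dflt {1..m} False (\<lambda>_. UNIV)" "f' \<in> PiE_dflt {1..m} False (\<lambda>_. UNIV)"
      using f(1,2) set_Pi_pmf_subset'[of "{1..m}" False "\<lambda>_. bernoulli_pmf (1 / real n)"]
      by (auto simp: P_def PiE_dflt_def)
    then show "f g = f' g"
      using f(3) by (cases "g \<in> {1..m}") (auto simp: b_def PiE_dflt_def)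
  qed
  have BB: "b (\<lambda>g. g \<in> B) = B"
    using B by (auto simp: b_def)
  have val: "pmf P (\<lambda>g. g \<in> B) = (1 / n) ^ card B * (1 - 1 / n) ^ (m - card B)"
  proof -
    have "pmf P (\<lambda>g. g \<in> B) = (\<Prod>g\<in>{1..m}. pmf (bernoulli_pmf (1 / real n)) (g \<in> B))"
      unfolding P_def using B by (subst pmf_Pi) auto
    also have "\<dots> = (\<Prod>g\<in>{1..m}. if g \<in> B then 1 / real n else 1 - 1 / real n)"
      using n by (intro prod.cong) auto
    also have "\<dots> = (1 / n) ^ card ({1..m} \<inter> B) * (1 - 1 / n) ^ card ({1..m} \<inter> - B)"
      by (subst prod.If_cases) auto
    also have "{1..m} \<inter> B = B" using B by auto
    also have "{1..m} \<inter> - B = {1..m} - B" by auto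
    also have "card ({1..m} - B) = m - card B"
      using B by (subst card_Diff_subset) (auto intro: finite_subset)
    finally show ?thesis .
  qed
  have "pmf P (\<lambda>g. g \<in> B) > 0"
    unfolding val using n by (intro mult_pos_pos zero_less_power) auto
  then have "(\<lambda>g. g \<in> B) \<in> set_pmf P"
    by (simp add: set_pmf_iff)
  from pmf_map_inj[OF inj this] show ?thesis
    unfolding BB val by (simp add: random_bundle_def P_def b_def)
qed

lemma prob_random_bundle:
  assumes "n \<ge> 2" and "G \<subseteq> Pow {1..m}"
  shows "measure_pmf.prob (random_bundle m n) G =
    (\<Sum>B\<in>G. (1 / n) ^ card B * (1 - 1 / n) ^ (m - card B))"
proof -
  have "finite G"
    using assms(2) by (rule finite_subset) simp
  then have "measure_pmf.prob (random_bundle m n) G = (\<Sum>B\<in>G. pmf (random_bundle m n) B)"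
    by (rule measure_measure_pmf_finite)
  also have "\<dots> = (\<Sum>B\<in>G. (1 / n) ^ card B * (1 - 1 / n) ^ (m - card B))"
    using assms by (intro sum.cong refl pmf_random_bundle) auto
  finally show ?thesis .
qed

text \<open>
  The inequality is strict because \<open>v\<close> takes finitely many values on bundles of goods: either no value is below the
  share, or \<open>v X\<close> is below the share exactly when it is at most the next smaller value, and that value
  was too small to qualify as a quantile.
\<close>

lemma prob_random_bundle_less_quantile_share:
  assumes "0 < q" "q \<le> 1"
  shows "measure_pmf.prob (random_bundle m n) {X. v X < quantile_share q m v n} < q"
proof -
  let ?P = "measure_pmf.prob (random_bundle m n)"
  let ?V = "v ` Pow {1..m}"
  define T where "T = {t \<in> ?V. ?P {X. v X \<le> t} \<ge> q}"
  define W where "W = {t \<in> ?V. t < Min T}"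
  have fin: "finite ?V" "finite T" "finite W"
    by (auto simp: T_def W_def)
  have supp: "?P A = ?P (A \<inter> Pow {1..m})" for A
    using set_pmf_random_bundle[of m n]
    by (metis (no_types, lifting) Int_absorb1 inf.assoc inf_commute measure_Int_set_pmf)
  have tau: "quantile_share q m v n = Min T"
    by (simp add: quantile_share_def T_def)
  show ?thesis
  proof (cases "W = {}")
    case True
    then have e: "{X. v X < Min T} \<inter> Pow {1..m} = {}"
      by (auto simp: W_def)
    show ?thesis
      unfolding tau supp[of "{X. v X < Min T}"] e using assms by simp
  next
    case False
    then have W: "Max W \<in> W"
      using fin by simp
    have sub: "{X. v X < Min T} \<inter> Pow {1..m} \<subseteq> {X. v X \<le> Max W}"
      using fin by (auto simp: W_def)
    have "Max W \<notin> T"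
    proof
      assume "Max W \<in> T"
      then have "Min T \<le> Max W"
        using fin by simp
      moreover have "\<forall>w\<in>W. w < Min T"
        by (simp add: W_def)
      ultimately show False
        using W by (meson leD)
    qed
    moreover have "W \<subseteq> ?V"
      by (auto simp: W_def)
    ultimately have "?P {X. v X \<le> Max W} < q"
      using W by (auto simp: T_def)
    moreover have "?P {X. v X < Min T} \<le> ?P {X. v X \<le> Max W}"
      unfolding supp[of "{X. v X < Min T}"] by (rule measure_pmf.finite_measure_mono[OF sub]) simp
    ultimately show ?thesis
      unfolding tau by simp
  qed
qed

section \<open>Limits of ratios of binomial coefficients\<close>

text \<open>
  For \<open>0 \<le> k \<le> N\<close> this is the usual absorption identity; with real subtraction it also holds for
  \<open>k > N\<close>, where both binomial coefficients vanish.
\<close>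

lemma binomial_pred_upper:
  assumes "N > 0"
  shows "real ((N - 1) choose k) = real (N choose k) * ((real N - real k) / real N)"
proof (cases "k \<le> N")
  case True
  have "(N - k) * (N choose k) = N * ((N - 1) choose k)"
    by (rule binomial_absorb_comp)
  then have "real (N - k) * real (N choose k) = real N * real ((N - 1) choose k)"
    by (metis of_nat_mult)
  then show ?thesis
    using True assms by (simp add: of_nat_diff field_simps)
qed (use assms in \<open>simp add: binomial_eq_0\<close>)

lemma binomial_pred_both:
  assumes "N > 0" "k > 0"
  shows "real ((N - 1) choose (k - 1)) = real (N choose k) * (real k / real N)"
proof -
  have "k * (N choose k) = N * ((N - 1) choose (k - 1))"
    using times_binomial_minus1_eq[OF assms(2)] .
  then have "real k * real (N choose k) = real N * real ((N - 1) choose (k - 1))"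
    by (metis of_nat_mult)
  then show ?thesis
    using assms by (simp add: field_simps)
qed

lemma tendsto_shifted_quotient:
  fixes f g :: "'a \<Rightarrow> real"
  assumes g: "filterlim g at_top F" and fg: "((\<lambda>x. f x / g x) \<longlongrightarrow> p) F"
  shows "((\<lambda>x. (f x - c) / (g x - d)) \<longlongrightarrow> p) F"
proof -
  have z: "((\<lambda>x. c / g x) \<longlongrightarrow> 0) F" for c
    using tendsto_divide_0[OF tendsto_const] filterlim_at_top_imp_at_infinity[OF g] by blast
  have "((\<lambda>x. (f x / g x - c / g x) / (1 - d / g x)) \<longlongrightarrow> (p - 0) / (1 - 0)) F"
    by (intro tendsto_intros fg z) simp
  moreover have "eventually (\<lambda>x. (f x / g x - c / g x) / (1 - d / g x) = (f x - c) / (g x - d)) F"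
    using filterlim_at_top_dense[THEN iffD1, OF g, rule_format, of 0]
  proof eventually_elim
    case (elim x)
    then have "f x / g x - c / g x = (f x - c) / g x" "1 - d / g x = (g x - d) / g x"
      by (simp_all add: diff_divide_distrib)
    then show ?case
      unfolding \<open>f x / g x - c / g x = _\<close> \<open>1 - d / g x = _\<close> using elim by simp
  qed
  ultimately have "((\<lambda>x. (f x - c) / (g x - d)) \<longlongrightarrow> (p - 0) / (1 - 0)) F"
    by (rule Lim_transform_eventually)
  then show ?thesis
    by simp
qed

text \<open>
  The number of \<open>k\<close>-subsets of an \<open>M\<close>-set that have a prescribed intersection, of size \<open>b\<close>, with
  a fixed set of size \<open>b + j\<close> is \<open>M - b - j choose (k - b)\<close>.  For \<open>k / M\<close> tending to \<open>p\<close>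
  the memberships of finitely many points in a uniformly random \<open>k\<close>-subset become independent in the
  limit, each with probability \<open>p\<close>: fixing one more point to lie inside or outside multiplies the
  count by \<open>(k - c) / (M - d)\<close> or \<open>(M - k - c) / (M - d)\<close> for constants \<open>c\<close> and \<open>d\<close>.
\<close>

lemma tendsto_binomial_ratio:
  fixes K M :: "nat \<Rightarrow> nat"
  assumes K: "filterlim K at_top sequentially" and KM: "\<And>L. K L \<le> M L"
    and p: "(\<lambda>L. real (K L) / real (M L)) \<longlonglongrightarrow> p"
  shows "(\<lambda>L. real ((M L - b - j) choose (K L - b)) / real (M L choose K L))
    \<longlonglongrightarrow> p ^ b * (1 - p) ^ j"
proof -
  have M: "filterlim M at_top sequentially"
    using filterlim_at_top_mono[OF K] KM by simp
  have rM: "filterlim (\<lambda>L. real (M L)) at_top sequentially"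
    by (rule filterlim_compose[OF filterlim_real_sequentially M])
  have evM: "eventually (\<lambda>L. c < M L) sequentially" for c
    using M[unfolded filterlim_at_top, rule_format, of "Suc c"] by (simp add: Suc_le_eq)
  have evK: "eventually (\<lambda>L. c < K L) sequentially" for c
    using K[unfolded filterlim_at_top, rule_format, of "Suc c"] by (simp add: Suc_le_eq)
  show ?thesis
  proof (induction j)
    case 0
    show ?case
    proof (induction b)
      case 0
      show ?case
        by (simp add: KM leD)
    next
      case (Suc b)
      have "(\<lambda>L. real ((M L - b - 0) choose (K L - b)) / real (M L choose K L)
          * ((real (K L) - real b) / (real (M L) - real b))) \<longlonglongrightarrow> p ^ b * (1 - p) ^ 0 * p"
        by (intro tendsto_mult Suc tendsto_shifted_quotient rM p)
      moreover have "eventually (\<lambda>L. real ((M L - b - 0) choose (K L - b)) / real (M L choose K L)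
          * ((real (K L) - real b) / (real (M L) - real b))
          = real ((M L - Suc b - 0) choose (K L - Suc b)) / real (M L choose K L)) sequentially"
        using evM[of b] evK[of b]
      proof eventually_elim
        case (elim L)
        then show ?case
          using binomial_pred_both[of "M L - b" "K L - b"] by (simp add: of_nat_diff)
      qed
      ultimately have "(\<lambda>L. real ((M L - Suc b - 0) choose (K L - Suc b)) / real (M L choose K L))
          \<longlonglongrightarrow> p ^ b * (1 - p) ^ 0 * p"
        by (rule Lim_transform_eventually)
      then show ?case
        by (simp only: power_Suc mult_ac)
    qed
  next
    case (Suc j)
    have "(\<lambda>L. 1 - real (K L) / real (M L)) \<longlonglongrightarrow> 1 - p"
      by (intro tendsto_intros p)
    moreover have "eventually (\<lambda>L. 1 - real (K L) / real (M L) = (real (M L) - real (K L)) / real (M L))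
        sequentially"
      using evM[of 0] by eventually_elim (simp add: field_simps)
    ultimately have q: "(\<lambda>L. (real (M L) - real (K L)) / real (M L)) \<longlonglongrightarrow> 1 - p"
      by (simp cong: tendsto_cong)
    have "(\<lambda>L. real ((M L - b - j) choose (K L - b)) / real (M L choose K L)
        * ((real (M L) - real (K L) - real j) / (real (M L) - real (b + j))))
        \<longlonglongrightarrow> p ^ b * (1 - p) ^ j * (1 - p)"
      by (intro tendsto_mult Suc tendsto_shifted_quotient rM q)
    moreover have "eventually (\<lambda>L. real ((M L - b - j) choose (K L - b)) / real (M L choose K L)
        * ((real (M L) - real (K L) - real j) / (real (M L) - real (b + j)))
        = real ((M L - b - Suc j) choose (K L - b)) / real (M L choose K L)) sequentially"
      using evM[of "b + j"] evK[of b]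
    proof eventually_elim
      case (elim L)
      then show ?case
        using binomial_pred_upper[of "M L - b - j" "K L - b"] by (simp add: of_nat_diff algebra_simps)
    qed
    ultimately have "(\<lambda>L. real ((M L - b - Suc j) choose (K L - b)) / real (M L choose K L))
        \<longlonglongrightarrow> p ^ b * (1 - p) ^ j * (1 - p)"
      by (rule Lim_transform_eventually)
    then show ?case
      by (simp only: power_Suc mult_ac)
  qed
qed

text \<open>
  This is \<open>(a choose k) / (b choose k) \<le> (a / b) ^ k\<close> without division: each factor
  \<open>(a - i) / (b - i)\<close> of the left-hand side is at most \<open>a / b\<close>.
\<close>

lemma binomial_mult_power_mono:
  assumes "a \<le> b"
  shows "(a choose k) * b ^ k \<le> (b choose k) * a ^ k"
proof (induction k)
  case (Suc k)
  have step: "Suc k * (N choose Suc k) = (N choose k) * (N - k)" for N :: nat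
    using binomial_absorb_comp[of N k] binomial_absorption[of k N]
    by (cases N) (simp_all add: mult.commute)
  have "(a - k) * b \<le> (b - k) * a"
    using mult_le_mono2[OF assms, of k] by (simp add: diff_mult_distrib mult.commute[of b a] diff_le_mono2)
  then have "((a choose k) * b ^ k) * ((a - k) * b) \<le> ((b choose k) * a ^ k) * ((b - k) * a)"
    by (rule mult_mono[OF Suc]) simp_all
  moreover have "Suc k * ((x choose Suc k) * y ^ Suc k) = ((x choose k) * y ^ k) * ((x - k) * y)" for x y
  proof -
    have "Suc k * ((x choose Suc k) * y ^ Suc k) = ((x choose k) * (x - k)) * (y * y ^ k)"
      unfolding step[symmetric] power_Suc by (rule mult.assoc[symmetric])
    then show ?thesis
      by (simp only: mult_ac)
  qed
  ultimately have "Suc k * ((a choose Suc k) * b ^ Suc k) \<le> Suc k * ((b choose Suc k) * a ^ Suc k)"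
    by presburger
  then show ?case
    by (metis Suc_mult_le_cancel1)
qed simp

text \<open>
  The ratio is at most \<open>(n L\<^sup>2 / (n L\<^sup>2 + L)) ^ L\<^sup>2 = (1 - 1 / (n L + 1)) ^ L\<^sup>2\<close>.  The ground set
  exceeds \<open>n L\<^sup>2\<close> by only a fraction of order \<open>1 / (n L)\<close>, but the exponent \<open>L\<^sup>2\<close> outweighs it.
\<close>

lemma tendsto_clique_ratio:
  assumes "n > 0"
  shows "(\<lambda>L. real ((L\<^sup>2 * n - 1) choose L\<^sup>2) / real ((n * L\<^sup>2 + L) choose L\<^sup>2)) \<longlonglongrightarrow> 0"
proof (rule tendsto_sandwich[OF _ _ tendsto_const])
  show "eventually (\<lambda>L. real ((L\<^sup>2 * n - 1) choose L\<^sup>2) / real ((n * L\<^sup>2 + L) choose L\<^sup>2)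
      \<le> exp (- (real L ^ 2 / (real n * real L + 1)))) sequentially"
    using eventually_gt_at_top[of 0]
  proof eventually_elim
    case (elim L)
    let ?a = "L\<^sup>2 * n" and ?M = "n * L\<^sup>2 + L"
    have "L\<^sup>2 \<le> n * L\<^sup>2" using assms by simp
    then have pos: "?M choose L\<^sup>2 > 0"
      by (intro zero_less_binomial trans_le_add1)
    have "((?a - 1) choose L\<^sup>2) * ?M ^ L\<^sup>2 \<le> (?a choose L\<^sup>2) * ?M ^ L\<^sup>2"
      by (intro mult_right_mono binomial_right_mono) simp_all
    also have "\<dots> \<le> (?M choose L\<^sup>2) * ?a ^ L\<^sup>2"
      by (rule binomial_mult_power_mono) (simp add: mult.commute)
    finally have "real ((?a - 1) choose L\<^sup>2) * real ?M ^ L\<^sup>2 \<le> real (?M choose L\<^sup>2) * real ?a ^ L\<^sup>2"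
      by (metis of_nat_le_iff of_nat_mult of_nat_power)
    moreover have "x / c \<le> z / y" if "x * y \<le> c * z" "c > 0" "y > 0" for x y c z :: real
      using that by (simp add: field_simps)
    moreover have "real (?M choose L\<^sup>2) > 0"
      using pos by (simp only: of_nat_0_less_iff)
    moreover have "real ?M ^ L\<^sup>2 > 0"
      by (rule zero_less_power) (simp only: of_nat_0_less_iff add_gr_0 elim simp_thms)
    ultimately have "real ((?a - 1) choose L\<^sup>2) / real (?M choose L\<^sup>2) \<le> (real ?a / real ?M) ^ L\<^sup>2"
      unfolding power_divide by blast
    also have "real ?a / real ?M = 1 - 1 / (real n * real L + 1)"
    proof -
      define y where "y = real n * real L + 1"
      have "y > 0"
        by (simp add: y_def add_nonneg_pos)
      have "real ?a = real L * (y - 1)" "real ?M = real L * y"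
        by (simp_all add: y_def power2_eq_square algebra_simps)
      then have "real ?a / real ?M = (y - 1) / y"
        using elim by simp
      also have "\<dots> = 1 - 1 / y"
        using \<open>y > 0\<close> by (simp add: diff_divide_distrib)
      finally show ?thesis
        unfolding y_def .
    qed
    also have "(1 - 1 / (real n * real L + 1)) ^ L\<^sup>2 \<le> exp (- (1 / (real n * real L + 1))) ^ L\<^sup>2"
    proof (rule power_mono)
      show "1 - 1 / (real n * real L + 1) \<le> exp (- (1 / (real n * real L + 1)))"
        using exp_ge_add_one_self[of "- (1 / (real n * real L + 1))"] by simp
      have "real n * real L \<ge> 0"
        by simp
      then have "1 / (real n * real L + 1) \<le> 1"
        by (intro divide_le_eq_1[THEN iffD2] disjI1 conjI) linarith+
      then show "0 \<le> 1 - 1 / (real n * real L + 1)"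
        by simp
    qed
    also have "\<dots> = exp (- (real L ^ 2 / (real n * real L + 1)))"
      by (simp flip: exp_of_nat_mult)
    finally show ?case .
  qed
  have "real n > 0" using assms by simp
  then show "(\<lambda>L. exp (- (real L ^ 2 / (real n * real L + 1)))) \<longlonglongrightarrow> 0"
    by real_asymp
qed simp

text \<open>
  With \<open>x = n - 1\<close> the right-hand side is the reciprocal of \<open>(1 + 1 / x) ^ x\<close>, which is at most \<open>e\<close>.
\<close>

lemma inverse_exp_le_power:
  assumes "n \<ge> 2"
  shows "1 / exp 1 \<le> (1 - 1 / real n) ^ (n - 1)"
proof -
  define x where "x = real n - 1"
  have x: "x > 0" and nx: "real (n - 1) = x" "real n = x + 1"
    using assms by (simp_all add: x_def)
  have "(1 + 1 / x) ^ (n - 1) \<le> exp (1 / x) ^ (n - 1)"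
    using x exp_ge_add_one_self[of "1 / x"] by (intro power_mono) auto
  also have "\<dots> = exp (real (n - 1) * (1 / x))"
    by (rule exp_of_nat_mult[symmetric])
  also have "\<dots> = exp 1"
    unfolding nx using x by simp
  finally have "1 / exp 1 \<le> 1 / (1 + 1 / x) ^ (n - 1)"
    using x by (intro divide_left_mono mult_pos_pos zero_less_power) (auto intro: add_pos_pos)
  also have "\<dots> = (1 - 1 / real n) ^ (n - 1)"
    using x by (simp add: nx(2) power_one_over[symmetric] field_simps flip: power_divide)
  finally show ?thesis .
qed

section \<open>From biased measures to uniform families\<close>

text \<open>
  The remaining \<open>k - card B\<close> elements are chosen freely from \<open>{m + 1..M}\<close>; by \<open>m \<le> k\<close> this
  difference of naturals does not truncate.
\<close>

lemma card_nsets_prescribed_trace: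
  assumes B: "B \<subseteq> {1..m}" and m: "m \<le> M" "m \<le> k"
  shows "card {A \<in> nsets {1..M} k. A \<inter> {1..m} = B} = (M - m) choose (k - card B)"
proof -
  have fB: "finite B" using B finite_subset by blast
  have cB: "card B \<le> m" using B card_mono[of "{1..m}" B] by simp
  have "bij_betw (\<lambda>C. C \<union> B) (nsets {m+1..M} (k - card B)) {A \<in> nsets {1..M} k. A \<inter> {1..m} = B}"
  proof (rule bij_betw_byWitness[where f' = "\<lambda>A. A - {1..m}"])
    show "\<forall>C\<in>nsets {m+1..M} (k - card B). (C \<union> B) - {1..m} = C"
      using B by (force simp: nsets_def)
    show "\<forall>A\<in>{A \<in> nsets {1..M} k. A \<inter> {1..m} = B}. (A - {1..m}) \<union> B = A"
      by auto
    show "(\<lambda>C. C \<union> B) ` nsets {m+1..M} (k - card B) \<subseteq> {A \<in> nsets {1..M} k. A \<inter> {1..m} = B}"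
    proof safe
      fix C assume C: "C \<in> nsets {m+1..M} (k - card B)"
      then have "C \<inter> B = {}"
        using B by (force simp: nsets_def)
      then have "card (C \<union> B) = k"
        using C fB cB m by (simp add: nsets_def card_Un_disjoint)
      moreover have "C \<union> B \<subseteq> {1..M}"
        using C B m by (force simp: nsets_def)
      ultimately show "C \<union> B \<in> nsets {1..M} k"
        using C fB by (simp add: nsets_def)
      show "x \<in> B" if "x \<in> C" "x \<in> {1..m}" for x
        using that C by (force simp: nsets_def)
      show "x \<in> {1..m}" if "x \<in> B" for x
        using that B by auto
    qed
    show "(\<lambda>A. A - {1..m}) ` {A \<in> nsets {1..M} k. A \<inter> {1..m} = B} \<subseteq> nsets {m+1..M} (k - card B)"
    proof safe
      fix A assume A: "A \<in> nsets {1..M} k" "B = A \<inter> {1..m}"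
      have "A - {1..m} \<subseteq> {m+1..M}"
        using A(1) by (auto simp: nsets_def)
      moreover have "card (A - {1..m}) = k - card (A \<inter> {1..m})"
        using A(1) by (subst card_Diff_subset_Int) (auto simp: nsets_def)
      ultimately show "A - {1..m} \<in> nsets {m+1..M} (k - card (A \<inter> {1..m}))"
        using A(1) by (simp add: nsets_def)
    qed
  qed
  from bij_betw_same_card[OF this] show ?thesis
    by (simp add: card_nsets)
qed

lemma card_nsets_trace_in:
  assumes "G \<subseteq> Pow {1..m}" and "m \<le> M" "m \<le> k"
  shows "card {A \<in> nsets {1..M} k. A \<inter> {1..m} \<in> G} = (\<Sum>B\<in>G. (M - m) choose (k - card B))"
proof -
  have fin: "finite G" "finite (nsets {1..M} k)"
    using assms(1) by (auto intro: finite_subset finite_imp_finite_nsets)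
  have "{A \<in> nsets {1..M} k. A \<inter> {1..m} \<in> G} = (\<Union>B\<in>G. {A \<in> nsets {1..M} k. A \<inter> {1..m} = B})"
    by auto
  then have "card {A \<in> nsets {1..M} k. A \<inter> {1..m} \<in> G}
      = (\<Sum>B\<in>G. card {A \<in> nsets {1..M} k. A \<inter> {1..m} = B})"
    using fin by (subst card_UN_disjoint[symmetric]) auto
  also have "\<dots> = (\<Sum>B\<in>G. (M - m) choose (k - card B))"
    using assms by (intro sum.cong refl card_nsets_prescribed_trace) auto
  finally show ?thesis .
qed

text \<open>
  The consequence of the conjecture for the product measure with bias \<open>1 / n\<close>.  If no disjoint selection
  existed, the families of \<open>k\<close>-sets with trace in \<open>G j\<close> would be cross-dependent, but for the chosen
  \<open>k\<close> and \<open>M\<close> their limiting densities all exceed that of the conjectured bound.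
\<close>

lemma disjoint_selection_of_large_measure:
  fixes G :: "nat \<Rightarrow> nat set set"
  assumes EMC: rainbow_Erdos_Matching_Conjecture
    and n: "n \<ge> 2"
    and G: "\<And>j. j \<in> {1..n} \<Longrightarrow> G j \<subseteq> Pow {1..m}"
    and large: "\<And>j. j \<in> {1..n} \<Longrightarrow> measure_pmf.prob (random_bundle m n) (G j) > 1 - 1 / exp 1"
  shows "\<exists>F. (\<forall>j\<in>{1..n}. F j \<in> G j) \<and> disjoint_family_on F {1..n}"
proof (rule ccontr)
  assume none: "\<not> ?thesis"
  \<comment> \<open>The excess \<open>M - n K = L\<close> is negligible against \<open>K\<close>, yet large enough to make the clique term vanish.\<close>
  define K M where "K = (\<lambda>L::nat. L\<^sup>2)" and "M = (\<lambda>L::nat. n * L\<^sup>2 + L)"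
  define \<F> where "\<F> = (\<lambda>L j. {A \<in> nsets {1..M L} (K L). A \<inter> {1..m} \<in> G j})"
  define C where "C = (\<lambda>L. real (M L choose K L))"
  have K: "filterlim K at_top sequentially"
    unfolding K_def by (rule filterlim_at_top_mono[OF filterlim_ident]) (simp add: power2_nat_le_imp_le power2_eq_square)
  have KM: "K L \<le> M L" for L
    using n by (simp add: K_def M_def trans_le_add1)
  have n0: "real n > 0" using n by simp
  have p: "(\<lambda>L. real (K L) / real (M L)) \<longlonglongrightarrow> 1 / real n"
  proof (rule tendsto_eq_rhs)
    show "(\<lambda>L. real (K L) / real (M L)) \<longlonglongrightarrow> inverse (real n)"
      unfolding K_def M_def of_nat_add of_nat_mult of_nat_power using n0 by real_asymp
  qed (simp add: inverse_eq_divide)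
  have ratio: "(\<lambda>L. real ((M L - b - j) choose (K L - b)) / C L)
      \<longlonglongrightarrow> (1 / real n) ^ b * (1 - 1 / real n) ^ j" for b j
    unfolding C_def by (rule tendsto_binomial_ratio[OF K KM p])
  have star: "(\<lambda>L. 1 - real ((M L - n + 1) choose K L) / C L) \<longlonglongrightarrow> 1 - (1 - 1 / real n) ^ (n - 1)"
  proof -
    have "M L - (n - 1) = M L - n + 1" if "L > 0" for L
    proof -
      have "n \<le> n * L\<^sup>2" using that by simp
      then have "n \<le> M L" unfolding M_def by (rule trans_le_add1)
      then show ?thesis using n by simp
    qed
    then have "eventually (\<lambda>L. M L - (n - 1) = M L - n + 1) sequentially"
      by (rule eventually_mono[OF eventually_gt_at_top[of 0]])
    then have "eventually (\<lambda>L. 1 - real ((M L - (n - 1)) choose K L) / C L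
        = 1 - real ((M L - n + 1) choose K L) / C L) sequentially"
      by eventually_elim simp
    moreover have "(\<lambda>L. 1 - real ((M L - (n - 1)) choose K L) / C L)
        \<longlonglongrightarrow> 1 - (1 - 1 / real n) ^ (n - 1)"
      using ratio[of 0 "n - 1"] by (intro tendsto_diff tendsto_const) simp
    ultimately show ?thesis
      by (rule Lim_transform_eventually[rotated])
  qed
  have clique: "(\<lambda>L. real ((K L * n - 1) choose K L) / C L) \<longlonglongrightarrow> 0"
    using tendsto_clique_ratio[of n] n by (simp add: K_def M_def C_def)
  have bound: "(\<lambda>L. max (1 - real ((M L - n + 1) choose K L) / C L) (real ((K L * n - 1) choose K L) / C L))
      \<longlonglongrightarrow> max (1 - (1 - 1 / real n) ^ (n - 1)) 0"
    by (intro tendsto_max star clique)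
  have evm: "eventually (\<lambda>L. m \<le> K L) sequentially"
    using K by (simp add: filterlim_at_top)
  have family: "(\<lambda>L. real (card (\<F> L j)) / C L) \<longlonglongrightarrow> measure_pmf.prob (random_bundle m n) (G j)"
    if j: "j \<in> {1..n}" for j
  proof -
    have cB: "card B \<le> m" if "B \<in> G j" for B
      using G[OF j] that card_mono[of "{1..m}" B] by auto
    have "(\<lambda>L. \<Sum>B\<in>G j. real ((M L - card B - (m - card B)) choose (K L - card B)) / C L)
        \<longlonglongrightarrow> (\<Sum>B\<in>G j. (1 / n) ^ card B * (1 - 1 / n) ^ (m - card B))"
      by (intro tendsto_sum ratio)
    moreover have "eventually (\<lambda>L. (\<Sum>B\<in>G j. real ((M L - card B - (m - card B)) choose (K L - card B)) / C L)
        = real (card (\<F> L j)) / C L) sequentially"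
      using evm
    proof eventually_elim
      case (elim L)
      then have "card (\<F> L j) = (\<Sum>B\<in>G j. (M L - m) choose (K L - card B))"
        unfolding \<F>_def using G[OF j] KM[of L] by (intro card_nsets_trace_in) auto
      then show ?case
        using cB by (simp add: sum_divide_distrib)
    qed
    ultimately have "(\<lambda>L. real (card (\<F> L j)) / C L)
        \<longlonglongrightarrow> (\<Sum>B\<in>G j. (1 / n) ^ card B * (1 - 1 / n) ^ (m - card B))"
      by (rule Lim_transform_eventually)
    then show ?thesis
      using prob_random_bundle[OF n G[OF j]] by simp
  qed
  have "eventually (\<lambda>L. max (1 - real ((M L - n + 1) choose K L) / C L) (real ((K L * n - 1) choose K L) / C L)
      < real (card (\<F> L j)) / C L) sequentially" if j: "j \<in> {1..n}" for j
  proof -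
    have "max (1 - (1 - 1 / real n) ^ (n - 1)) 0 < measure_pmf.prob (random_bundle m n) (G j)"
    proof -
      have "1 / exp 1 \<le> (1 :: real)"
        by simp
      then show ?thesis
        using large[OF j] inverse_exp_le_power[OF n] unfolding max_less_iff_conj by linarith
    qed
    then have "0 < measure_pmf.prob (random_bundle m n) (G j) - max (1 - (1 - 1 / real n) ^ (n - 1)) 0"
      by simp
    from order_tendstoD(1)[OF tendsto_diff[OF family[OF j] bound] this] show ?thesis
      by eventually_elim simp
  qed
  then have ev: "eventually (\<lambda>L. \<forall>j\<in>{1..n}. max (1 - real ((M L - n + 1) choose K L) / C L)
      (real ((K L * n - 1) choose K L) / C L) < real (card (\<F> L j)) / C L) sequentially"
    by (intro eventually_ball_finite) auto
  from eventually_happens'[OF sequentially_bot eventually_conj[OF ev eventually_gt_at_top[of 0]]]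
  obtain L where L: "L > 0" and big: "\<And>j. j \<in> {1..n} \<Longrightarrow>
      max (1 - real ((M L - n + 1) choose K L) / C L) (real ((K L * n - 1) choose K L) / C L)
        < real (card (\<F> L j)) / C L"
    by (elim exE conjE) (rule that, assumption, drule bspec)
  have cross: "cross_dependent n (\<F> L)"
    unfolding cross_dependent_def
  proof
    assume "\<exists>F. (\<forall>j\<in>{1..n}. F j \<in> \<F> L j) \<and> disjoint_family_on F {1..n}"
    then obtain F where F: "\<forall>j\<in>{1..n}. F j \<in> \<F> L j" "disjoint_family_on F {1..n}"
      by blast
    then have "(\<forall>j\<in>{1..n}. F j \<inter> {1..m} \<in> G j) \<and> disjoint_family_on (\<lambda>j. F j \<inter> {1..m}) {1..n}"
      by (auto simp: \<F>_def disjoint_family_on_def)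
    then have "\<exists>F. (\<forall>j\<in>{1..n}. F j \<in> G j) \<and> disjoint_family_on F {1..n}"
      by (rule exI[of _ "\<lambda>j. F j \<inter> {1..m}"])
    with none show False
      by (rule notE)
  qed
  have C: "C L > 0"
    using KM by (simp add: C_def)
  have "Min ((\<lambda>j. card (\<F> L j)) ` {1..n})
      \<le> max ((M L choose K L) - ((M L - n + 1) choose K L)) ((K L * n - 1) choose K L)"
  proof -
    have "n > 0" "K L > 0" "M L > 0" "n * K L \<le> M L"
      using n L by (auto simp: K_def M_def)
    moreover have "\<forall>j\<in>{1..n}. \<F> L j \<subseteq> nsets {1..M L} (K L)"
      by (auto simp: \<F>_def)
    ultimately show ?thesis
      by (rule EMC[unfolded rainbow_Erdos_Matching_Conjecture_def, THEN spec, THEN spec, THEN spec,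
            THEN mp, THEN mp, THEN mp, THEN mp, THEN spec, THEN mp, THEN mp, OF _ _ _ _ _ cross])
  qed
  moreover have "Min ((\<lambda>j. card (\<F> L j)) ` {1..n}) \<in> (\<lambda>j. card (\<F> L j)) ` {1..n}"
    using n by (intro Min_in) auto
  ultimately obtain j where j: "j \<in> {1..n}" and
    le: "card (\<F> L j) \<le> max ((M L choose K L) - ((M L - n + 1) choose K L)) ((K L * n - 1) choose K L)"
    by auto
  have le2: "(M L - n + 1) choose K L \<le> M L choose K L"
  proof (rule binomial_right_mono)
    have "n \<le> n * L\<^sup>2" using L by simp
    then have "n \<le> M L" unfolding M_def by (rule trans_le_add1)
    then show "M L - n + 1 \<le> M L" using n by simp
  qed
  have big': "1 - real ((M L - n + 1) choose K L) / C L < real (card (\<F> L j)) / C L"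
    "real ((K L * n - 1) choose K L) / C L < real (card (\<F> L j)) / C L"
    using big[OF j] by (simp_all only: max_less_iff_conj)
  from le_max_iff_disj[THEN iffD1, OF le] show False
  proof
    assume "card (\<F> L j) \<le> (M L choose K L) - ((M L - n + 1) choose K L)"
    then have "real (card (\<F> L j)) \<le> C L - real ((M L - n + 1) choose K L)"
      unfolding C_def of_nat_diff[OF le2, symmetric] by (rule of_nat_mono)
    then have "real (card (\<F> L j)) / C L \<le> (C L - real ((M L - n + 1) choose K L)) / C L"
      using C by (intro divide_right_mono) simp_all
    also have "\<dots> = 1 - real ((M L - n + 1) choose K L) / C L"
      using C by (simp add: diff_divide_distrib)
    finally show False
      using big'(1) by linarith
  next
    assume "card (\<F> L j) \<le> (K L * n - 1) choose K L"
    then have "real (card (\<F> L j)) / C L \<le> real ((K L * n - 1) choose K L) / C L"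
      using C by (intro divide_right_mono of_nat_mono) simp_all
    then show False
      using big'(2) by linarith
  qed
qed

section \<open>Feasibility at and infeasibility above \<open>1 / e\<close>\<close>

lemma universally_feasible_quantile_share_inverse_e:
  assumes EMC: rainbow_Erdos_Matching_Conjecture
  shows "universally_feasible (quantile_share (1 / exp 1))"
  unfolding universally_feasible_def
proof (intro allI impI)
  fix n m :: nat and v :: "nat \<Rightarrow> nat set \<Rightarrow> real"
  assume n: "n \<ge> 2" and v: "\<forall>i\<in>{1..n}. monotone_valuation m (v i)"
  define t where "t = (\<lambda>i. quantile_share (1 / exp 1) m (v i) n)"
  define G where "G = (\<lambda>i. {A. A \<subseteq> {1..m} \<and> t i \<le> v i A})"
  have "\<exists>F. (\<forall>j\<in>{1..n}. F j \<in> G j) \<and> disjoint_family_on F {1..n}"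
  proof (rule disjoint_selection_of_large_measure[OF EMC n])
    show "G j \<subseteq> Pow {1..m}" for j
      by (auto simp: G_def)
    fix j
    let ?P = "measure_pmf.prob (random_bundle m n)"
    have "?P (G j) = ?P (- {X. v j X < t j})"
      using set_pmf_random_bundle[of m n] by (intro measure_eq_AE) (auto simp: G_def AE_measure_pmf_iff)
    also have "\<dots> = 1 - ?P {X. v j X < t j}"
      using measure_pmf.prob_compl[of "{X. v j X < t j}" "random_bundle m n"] by (simp add: Compl_eq_Diff_UNIV)
    finally show "?P (G j) > 1 - 1 / exp 1"
      using prob_random_bundle_less_quantile_share[of "1 / exp 1" m n "v j"] by (simp add: t_def)
  qed
  then obtain F where FG: "\<forall>j\<in>{1..n}. F j \<in> G j" and disj: "disjoint_family_on F {1..n}"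
    by blast
  have F: "F j \<subseteq> {1..m} \<and> t j \<le> v j (F j)" if "j \<in> {1..n}" for j
    using bspec[OF FG that] by (simp add: G_def)
  define R where "R = {1..m} - (\<Union>j\<in>{1..n}. F j)"
  \<comment> \<open>The goods left over by the selection go to the first agent, by monotonicity harmlessly.\<close>
  define S where "S = (\<lambda>j. if j = 1 then F j \<union> R else F j)"
  have FS: "F j \<subseteq> S j" for j
    by (simp add: S_def)
  have "disjoint_family_on S {1..n}"
    unfolding disjoint_family_on_def
  proof (intro ballI impI)
    fix i j assume ij: "i \<in> {1..n}" "j \<in> {1..n}" "i \<noteq> j"
    then have "F i \<inter> F j = {}"
      using disjoint_family_onD[OF disj] by simp
    moreover have "R \<inter> F k = {}" if "k \<in> {1..n}" for k
      using that by (auto simp: R_def)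
    from this[OF ij(1)] this[OF ij(2)] have "R \<inter> F i = {}" "R \<inter> F j = {}" .
    ultimately show "S i \<inter> S j = {}"
      using ij(3) by (auto simp: S_def)
  qed
  moreover have U: "(\<Union>i\<in>{1..n}. S i) = {1..m}"
  proof
    show "(\<Union>i\<in>{1..n}. S i) \<subseteq> {1..m}"
      using F by (fastforce simp: S_def R_def split: if_splits)
    have "R \<subseteq> S 1" "1 \<in> {1..n}"
      using n by (auto simp: S_def)
    then show "{1..m} \<subseteq> (\<Union>i\<in>{1..n}. S i)"
      using FS by (force simp: R_def)
  qed
  ultimately have "allocation m n S"
    by (simp add: allocation_def)
  moreover have "v i (S i) \<ge> t i" if i: "i \<in> {1..n}" for i
  proof -
    have "v i (F i) \<le> v i (S i)"
    proof -
      have "S i \<subseteq> {1..m}"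
        using i unfolding U[symmetric] by (rule UN_upper)
      moreover have "monotone_valuation m (v i)"
        using v i by (rule bspec)
      ultimately show ?thesis
        using FS[of i] by (simp add: monotone_valuation_def)
    qed
    then show ?thesis
      using F[OF i] by simp
  qed
  ultimately show "\<exists>S. allocation m n S \<and> (\<forall>i\<in>{1..n}. v i (S i) \<ge> quantile_share (1 / exp 1) m (v i) n)"
    by (auto simp: t_def)
qed

lemma not_universally_feasible_quantile_share_above_inverse_e:
  assumes q: "q < 1" "q > 1 / exp 1"
  shows "\<not> universally_feasible (quantile_share q)"
proof
  assume feas: "universally_feasible (quantile_share q)"
  have "(\<lambda>n. (1 - 1 / real n) ^ (n - 1)) \<longlonglongrightarrow> 1 / exp 1"
  proof -
    have "(\<lambda>n. (1 - 1 / real n) powr (real n - 1)) \<longlonglongrightarrow> 1 / exp 1"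
    proof (rule tendsto_eq_rhs)
      show "(\<lambda>n. (1 - 1 / real n) powr (real n - 1)) \<longlonglongrightarrow> exp (- 1)"
        by real_asymp
    qed (simp only: exp_minus inverse_eq_divide)
    moreover have "eventually (\<lambda>n. (1 - 1 / real n) powr (real n - 1) = (1 - 1 / real n) ^ (n - 1)) sequentially"
      using eventually_ge_at_top[of 2]
    proof eventually_elim
      case (elim n)
      then have "1 - 1 / real n > 0" "real n - 1 = real (n - 1)" by auto
      then show ?case by (simp only: powr_realpow)
    qed
    ultimately show ?thesis
      by (rule Lim_transform_eventually)
  qed
  from eventually_happens'[OF sequentially_bot
      eventually_conj[OF order_tendstoD(2)[OF this q(2)] eventually_ge_at_top[of 2]]]
  obtain n :: nat where small: "(1 - 1 / real n) ^ (n - 1) < q" and n: "n \<ge> 2"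
    by (elim exE conjE)
  define m where "m = n - 1"
  define v :: "nat set \<Rightarrow> real" where "v = (\<lambda>A. if A = {} then 0 else 1)"
  let ?P = "measure_pmf.prob (random_bundle m n)"
  have mono: "monotone_valuation m v"
    by (auto simp: monotone_valuation_def v_def)
  have "?P {{}} = (1 - 1 / real n) ^ (n - 1)"
    using prob_random_bundle[OF n, of "{{}}" m] by (simp add: m_def)
  moreover have "{X. v X \<le> 0} = {{}}"
    by (auto simp: v_def)
  ultimately have zero: "?P {X. v X \<le> 0} < q"
    using small by simp
  have "{t \<in> v ` Pow {1..m}. q \<le> ?P {X. v X \<le> t}} = {1}"
  proof (intro equalityI subsetI)
    fix t assume "t \<in> {t \<in> v ` Pow {1..m}. q \<le> ?P {X. v X \<le> t}}"
    then show "t \<in> {1}"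
      using zero by (auto simp: v_def split: if_splits)
  next
    fix t :: real assume "t \<in> {1}"
    moreover have "v {1} = 1" "{1} \<in> Pow {1..m}"
      using n by (auto simp: v_def m_def)
    moreover have "{X. v X \<le> 1} = UNIV"
      by (auto simp: v_def)
    ultimately show "t \<in> {t \<in> v ` Pow {1..m}. q \<le> ?P {X. v X \<le> t}}"
      using q by (auto simp: image_iff intro!: bexI[of _ "{1}"])
  qed
  then have tau: "quantile_share q m v n = 1"
    by (simp add: quantile_share_def)
  have "\<forall>i\<in>{1..n}. monotone_valuation m v"
    using mono by simp
  then obtain S where S: "allocation m n S" "\<forall>i\<in>{1..n}. v (S i) \<ge> 1"
    using feas[unfolded universally_feasible_def, THEN spec, THEN mp, OF n,
        THEN spec[of _ m], THEN spec[of _ "\<lambda>_. v"], THEN mp] unfolding tau by blast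
  have ne: "S i \<noteq> {}" if "i \<in> {1..n}" for i
    using S(2) that by (auto simp: v_def split: if_splits)
  have U: "(\<Union>i\<in>{1..n}. S i) = {1..m}" and disj: "disjoint_family_on S {1..n}"
    using S(1) by (simp_all add: allocation_def)
  have fin: "finite (S i)" if "i \<in> {1..n}" for i
  proof (rule finite_subset)
    show "S i \<subseteq> {1..m}"
      unfolding U[symmetric] using that by (rule UN_upper)
  qed simp
  have "n = (\<Sum>i\<in>{1..n}. 1)" by simp
  also have "\<dots> \<le> (\<Sum>i\<in>{1..n}. card (S i))"
    using ne fin by (intro sum_mono) (simp add: Suc_leI card_gt_0_iff)
  also have "\<dots> = card (\<Union>i\<in>{1..n}. S i)"
    using disj fin by (intro card_UN_disjoint[symmetric]) (simp_all add: disjoint_family_on_def)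
  also have "\<dots> = m"
    unfolding U by simp
  finally show False
    using n by (simp add: m_def)
qed

theorem theorem1p7:
  shows "(rainbow_Erdos_Matching_Conjecture \<longrightarrow> universally_feasible (quantile_share (1 / exp 1)))
    \<and> (\<forall>q::real. 0 < q \<and> q < 1 \<and> q > 1 / exp 1 \<longrightarrow> \<not> universally_feasible (quantile_share q))"
proof (intro conjI impI allI)
  assume rainbow_Erdos_Matching_Conjecture
  then show "universally_feasible (quantile_share (1 / exp 1))"
    by (rule universally_feasible_quantile_share_inverse_e)
next
  fix q :: real
  assume "0 < q \<and> q < 1 \<and> q > 1 / exp 1"
  then show "\<not> universally_feasible (quantile_share q)"
    by (intro not_universally_feasible_quantile_share_above_inverse_e) simp_all
qed

end
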